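(* Let $F\subset k[x_1,\ldots,x_n]$ be a squarefree Cremona set in degree $2$ satisfying the canonical restrictions, of short type, which is not doubly-stochastic. Then the corresponding graph $G_F$ is a circuit of length $\geq 3$ with nonempty first neighborhood. Moreover, $F$ is a $p$-involution if and only if the circuit has length $3$.
   Context: Let $k$ be a field and $n\ge 2$. For $v=(a_1,\ldots,a_n)\in\mathbb{N}^n$ write $\mathbf{x}^v=x_1^{a_1}\cdots x_n^{a_n}$. Let $F=\{\mathbf{x}^{v_1},\ldots,\mathbf{x}^{v_n}\}$ be a set of $n$ distinct monomials of the same degree; its log-matrix $A_F$ has $j$th column $v_j$. $F$ satisfies the canonical restrictions if the monomials have no non-trivial common factor and every variable divides at least one of them. $F$ is a Cremona set if the rational map $\mathbb{P}^{n-1}\dashrightarrow\mathbb{P}^{n-1}$ with coordinates $(\mathbf{x}^{v_1}:\cdots:\mathbf{x}^{v_n})$ is birational; it is in degree $2$ if the monomials have degree $2$, and squarefree if the monomials are squarefree. A set of squarefree monomials satisfying the canonical restrictions is doubly-stochastic if the entries of each column and the entries of each row of its log-matrix sum up to the same integer $d\ge 1$. For a Cremona set $F$ satisfying the canonical restrictions, there are a unique set $F^{-1}$ of $n$ monomials of a common degree satisfying the canonical restrictions, with log-matrix $A_{F^{-1}}$, and a unique vector $\gamma\in\mathbb{N}^n$ such that $A_F\cdot A_{F^{-1}}=[\gamma|\cdots|\gamma]+I_n$; $F^{-1}$ defines the inverse map. $F$ is a $p$-involution if it coincides with $F^{-1}$ up to permutations on the source and on the target, i.e. $A_{F^{-1}}=PA_FQ$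 for some permutation matrices $P,Q$. For $F$ squarefree in degree $2$, the simple graph $G_F$ has vertices $x_1,\ldots,x_n$ and an edge joining $x_i$ and $x_j$ for each $x_ix_j\in F$. For a squarefree Cremona set in degree $2$ satisfying the canonical restrictions, $G_F$ is connected with a unique circuit, which has odd length. The $j$th neighborhood of the circuit consists of the vertices at distance $j\ge 1$ from the circuit (with the edges joining them to vertices at distance $j-1$). $F$ is of short type if the circuit has empty second neighborhood. *)

theory Defs
  imports "HOL-Analysis.Finite_Cartesian_Product" "HOL-Library.Poly_Mapping"
begin

section \<open>Polynomials and rational maps\<close>

text \<open>
  The finite type \<open>'n\<close> indexes the variables; exponent vectors are elements of \<open>nat ^ 'n\<close>, and
  polynomials over \<open>'k\<close> are the finitely supported functions on exponent vectors, multiplied by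
  convolution.
\<close>

type_synonym ('n, 'k) mpol = "(nat ^ 'n) \<Rightarrow>\<^sub>0 'k"

definition mon :: "nat ^ 'n \<Rightarrow> ('n::finite, 'k::field) mpol" where
  "mon v = Poly_Mapping.single v 1"

definition var :: "'n \<Rightarrow> ('n::finite, 'k::field) mpol" where
  "var i = mon (axis i 1)"

definition mon_degree :: "nat ^ 'n::finite \<Rightarrow> nat" where
  "mon_degree v = (\<Sum>i\<in>UNIV. v $ i)"

definition form :: "nat \<Rightarrow> ('n::finite, 'k::field) mpol \<Rightarrow> bool" where
  "form d f \<longleftrightarrow> (\<forall>v\<in>Poly_Mapping.keys f. mon_degree v = d)"

text \<open>\<open>subst f g\<close> is the polynomial \<open>g(f\<^sub>1, \<dots>, f\<^sub>n)\<close>.\<close>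

definition subst :: "('n \<Rightarrow> ('n, 'k) mpol) \<Rightarrow> ('n, 'k) mpol \<Rightarrow> ('n::finite, 'k::field) mpol" where
  "subst f g = (\<Sum>v\<in>Poly_Mapping.keys g.
      Poly_Mapping.single 0 (Poly_Mapping.lookup g v) * (\<Prod>i\<in>UNIV. f i ^ (v $ i)))"

text \<open>
  A rational map from projective \<open>(n-1)\<close>-space to itself is given by \<open>n\<close> forms of a common degree,
  not all zero.  Two such tuples give the same rational map iff they are proportional
  over the field of rational functions; cross-multiplication expresses this because
  both tuples are required to be nonzero.
\<close>

definition rational_map :: "('n \<Rightarrow> ('n::finite, 'k::field) mpol) \<Rightarrow> bool" where
  "rational_map f \<longleftrightarrow> (\<exists>d. \<forall>i. form d (f i)) \<and> (\<exists>i. f i \<noteq> 0)"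

definition same_rational_map ::
    "('n \<Rightarrow> ('n::finite, 'k::field) mpol) \<Rightarrow> ('n \<Rightarrow> ('n, 'k) mpol) \<Rightarrow> bool" where
  "same_rational_map f g \<longleftrightarrow>
     rational_map f \<and> rational_map g \<and> (\<forall>i j. f i * g j = f j * g i)"

text \<open>
  The coordinates of the composite \<open>g \<circ> f\<close> are \<open>subst f (g i)\<close>.  That the two composites are
  defined, i.e. that these coordinates do not all vanish, is part of \<open>same_rational_map\<close>.
\<close>

definition birational :: "('n \<Rightarrow> ('n::finite, 'k::field) mpol) \<Rightarrow> bool" where
  "birational f \<longleftrightarrow> rational_map f \<and>
     (\<exists>g. rational_map g \<and>
        same_rational_map (\<lambda>i. subst f (g i)) var \<and>
        same_rational_map (\<lambda>i. subst g (f i)) var)"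

section \<open>Sets of monomials\<close>

text \<open>
  A set of \<open>n\<close> distinct monomials is given by a numbering \<open>F\<close> of their exponent vectors, which
  fixes the order of the columns of its log-matrix and the coordinates of its rational map.
\<close>

type_synonym 'n monomials = "'n \<Rightarrow> nat ^ 'n"

definition monomial_set :: "'n::finite monomials \<Rightarrow> bool" where
  "monomial_set F \<longleftrightarrow> inj F \<and> (\<exists>d. \<forall>j. mon_degree (F j) = d)"

definition in_degree :: "nat \<Rightarrow> 'n::finite monomials \<Rightarrow> bool" where
  "in_degree d F \<longleftrightarrow> (\<forall>j. mon_degree (F j) = d)"

definition squarefree_set :: "'n::finite monomials \<Rightarrow> bool" where
  "squarefree_set F \<longleftrightarrow> (\<forall>i j. F j $ i \<le> 1)"

definition log_matrix :: "'n::finite monomials \<Rightarrow> nat ^ 'n ^ 'n" where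
  "log_matrix F = (\<chi> i j. F j $ i)"

definition mon_dvd :: "nat ^ 'n::finite \<Rightarrow> nat ^ 'n \<Rightarrow> bool" where
  "mon_dvd v w \<longleftrightarrow> (\<forall>i. v $ i \<le> w $ i)"

definition canonical_restrictions :: "'n::finite monomials \<Rightarrow> bool" where
  "canonical_restrictions F \<longleftrightarrow>
     (\<forall>w. (\<forall>j. mon_dvd w (F j)) \<longrightarrow> w = 0) \<and>
     (\<forall>i. \<exists>j. mon_dvd (axis i 1) (F j))"

text \<open>The first argument only carries the ground field.\<close>

definition cremona_set :: "'k::field itself \<Rightarrow> 'n::finite monomials \<Rightarrow> bool" where
  "cremona_set k F \<longleftrightarrow> monomial_set F \<and> birational (\<lambda>j. mon (F j) :: ('n, 'k) mpol)"

definition doubly_stochastic :: "'n::finite monomials \<Rightarrow> bool" where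
  "doubly_stochastic F \<longleftrightarrow> squarefree_set F \<and> canonical_restrictions F \<and>
     (\<exists>d\<ge>1. (\<forall>j. (\<Sum>i\<in>UNIV. log_matrix F $ i $ j) = d) \<and>
            (\<forall>i. (\<Sum>j\<in>UNIV. log_matrix F $ i $ j) = d))"

text \<open>
  \<open>inverse_set F G\<close> says that \<open>G\<close> is the set \<open>F\<inverse>\<close>, numbered as the equation prescribes.  For a
  Cremona set \<open>F\<close> satisfying the canonical restrictions there is exactly one such \<open>G\<close>.
\<close>

definition inverse_set :: "'n::finite monomials \<Rightarrow> 'n monomials \<Rightarrow> bool" where
  "inverse_set F G \<longleftrightarrow> monomial_set G \<and> canonical_restrictions G \<and>
     (\<exists>\<gamma> :: nat ^ 'n. log_matrix F ** log_matrix G = (\<chi> i j. \<gamma> $ i) + mat 1)"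

definition permutation_matrix :: "nat ^ 'n ^ 'n::finite \<Rightarrow> bool" where
  "permutation_matrix P \<longleftrightarrow> (\<exists>\<pi>. bij \<pi> \<and> P = (\<chi> i j. if i = \<pi> j then 1 else 0))"

definition p_involution :: "'n::finite monomials \<Rightarrow> bool" where
  "p_involution F \<longleftrightarrow>
     (\<exists>G P Q. inverse_set F G \<and> permutation_matrix P \<and> permutation_matrix Q \<and>
        log_matrix G = P ** log_matrix F ** Q)"

section \<open>The graph of a squarefree set in degree 2\<close>

text \<open>The vertex set is \<open>UNIV :: 'n set\<close>; edges are two-element sets of vertices.\<close>

definition graph_edges :: "'n::finite monomials \<Rightarrow> 'n set set" where
  "graph_edges F = {{i, j} | i j. i \<noteq> j \<and> axis i 1 + axis j 1 \<in> range F}"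

text \<open>
  A circuit is identified with its edge set, so it has no distinguished starting vertex or
  orientation; its length is the number of its edges and its vertex set is their union.
\<close>

definition is_circuit :: "'n::finite monomials \<Rightarrow> 'n set set \<Rightarrow> bool" where
  "is_circuit F C \<longleftrightarrow> C \<subseteq> graph_edges F \<and>
     (\<exists>c. distinct c \<and> length c \<ge> 3 \<and>
        C = {{c ! t, c ! (Suc t mod length c)} | t. t < length c})"

definition adjacency :: "'n::finite monomials \<Rightarrow> ('n \<times> 'n) set" where
  "adjacency F = {(u, v). {u, v} \<in> graph_edges F}"

text \<open>
  The vertices at distance \<open>j\<close> from the circuit \<open>C\<close>; pairs in \<open>adjacency F ^^ j\<close> are those joined
  by a walk of length \<open>j\<close>.
\<close>

definition neighborhood :: "'n::finite monomials \<Rightarrow> 'n set set \<Rightarrow> nat \<Rightarrow> 'n set" where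
  "neighborhood F C j =
     {v. (\<exists>u\<in>\<Union>C. (u, v) \<in> adjacency F ^^ j) \<and>
         (\<forall>m<j. \<forall>u\<in>\<Union>C. (u, v) \<notin> adjacency F ^^ m)}"

text \<open>The edges joining the \<open>j\<close>th neighborhood (\<open>j \<ge> 1\<close>) to the vertices at distance \<open>j - 1\<close>.\<close>

definition neighborhood_edges :: "'n::finite monomials \<Rightarrow> 'n set set \<Rightarrow> nat \<Rightarrow> 'n set set" where
  "neighborhood_edges F C j =
     {{u, v} | u v. u \<in> neighborhood F C (j - 1) \<and> v \<in> neighborhood F C j \<and>
                    {u, v} \<in> graph_edges F}"

text \<open>
  For the Cremona sets under consideration the circuit is unique, so quantifying it existentially
  refers to that circuit.
\<close>

definition short_type :: "'n::finite monomials \<Rightarrow> bool" where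
  "short_type F \<longleftrightarrow> (\<exists>C. is_circuit F C \<and> neighborhood F C 2 = {})"

end

theory Submission
  imports Defs
begin

text \<open>
  Everything is read off from the graph, which has \<open>n\<close> vertices and \<open>n\<close> edges.

  Birationality makes the graph connected.  On a union \<open>S\<close> of connected
  components every monomial has degree \<open>0\<close> or \<open>2\<close>, so every polynomial in the monomials of \<open>F\<close> has
  only terms of even degree in the variables of \<open>S\<close>; but recovering the ratio of a variable in \<open>S\<close> and a variable
  outside \<open>S\<close> would require an odd degree (\<open>birational_even_on_imp_UNIV\<close>).

  An empty second neighborhood now means that every vertex off the circuit is adjacent to it.  The
  circuit together with one edge for each such vertex already has \<open>n\<close> edges, so it is the whole graph,
  the remaining vertices are leaves, and the circuit is unique (\<open>graph_edges_eq_circuit_leaves\<close>,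
  \<open>unique_circuit\<close>).  If there were no leaves, all vertices would have degree \<open>2\<close> and \<open>F\<close> would be
  doubly-stochastic.

  If \<open>F\<^sup>-\<^sup>1\<close> is a permuted copy of \<open>F\<close>, then each column of \<open>A\<^sub>F A\<close>, where \<open>A\<close> is the log-matrix of
  \<open>F\<^sup>-\<^sup>1\<close>, is a sum of two edges.  A vector \<open>\<gamma>\<close> that becomes a sum of two edges after adding any unit
  vector must be the indicator of a triangle (\<open>p_involution_imp_triangle\<close>).  Conversely, for a triangle with leaves such an inverse is
  written down explicitly from the bijection that sends each vertex of the triangle to the opposite
  edge and each leaf to its edge (\<open>triangle_imp_p_involution\<close>).
\<close>

section \<open>A parity obstruction to birationality\<close>

definition even_on :: "'n::finite set \<Rightarrow> ('n, 'k::field) mpol \<Rightarrow> bool" where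
  "even_on S p \<longleftrightarrow> (\<forall>v\<in>Poly_Mapping.keys p. even (\<Sum>i\<in>S. v $ i))"

lemma even_on_mult: "even_on S p \<Longrightarrow> even_on S q \<Longrightarrow> even_on S (p * q)"
  using keys_mult[of p q] by (fastforce simp: even_on_def sum.distrib)

lemma even_on_sum: "(\<And>x. x \<in> X \<Longrightarrow> even_on S (p x)) \<Longrightarrow> even_on S (sum p X)"
  using Poly_Mapping.keys_sum[of p X] by (fastforce simp: even_on_def)

lemma even_on_single: "even (\<Sum>i\<in>S. v $ i) \<Longrightarrow> even_on S (Poly_Mapping.single v a)"
  by (auto simp: even_on_def split: if_splits)

lemma even_on_one: "even_on S (1 :: ('n::finite, 'k::field) mpol)"
  unfolding single_one[symmetric] by (rule even_on_single) simp

lemma even_on_power: "even_on S p \<Longrightarrow> even_on S (p ^ m)"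
  by (induction m) (auto intro: even_on_one even_on_mult)

lemma even_on_prod: "(\<And>x. x \<in> X \<Longrightarrow> even_on S (p x)) \<Longrightarrow> even_on S (prod p X)"
  by (induction X rule: infinite_finite_induct) (auto intro: even_on_one even_on_mult)

lemma even_on_subst:
  assumes "\<And>i. even_on S (f i)"
  shows "even_on S (subst f g)"
  unfolding subst_def
  by (intro even_on_sum even_on_mult even_on_prod even_on_power even_on_single assms) simp

text \<open>
  Multiplication by a monomial only shifts exponents.  This makes monomials cancellable although
  exponent vectors carry no linear order from which the absence of zero divisors could be derived.
\<close>

lemma lookup_mon_mult: "Poly_Mapping.lookup (mon v * p) (v + w) = Poly_Mapping.lookup p w"
  by (simp add: mon_def lookup_mult lookup_single when_mult)

lemma mon_mult_eq_0_iff: "mon v * p = 0 \<longleftrightarrow> p = 0"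
  by (metis lookup_mon_mult lookup_zero mult_zero_right poly_mapping_eqI)

text \<open>
  Suppose that every coordinate of \<open>f\<close> only involves monomials of even degree in the variables
  of \<open>S\<close>.  Then so does every \<open>g\<^sub>i(f)\<close>.  If \<open>g\<close> inverts \<open>f\<close>, then \<open>g\<^sub>i(f) x\<^sub>j = g\<^sub>j(f) x\<^sub>i\<close>;
  for \<open>i \<in> S\<close> and \<open>j \<notin> S\<close> the left side is even and the right side is odd on \<open>S\<close>, so both vanish.
  Hence all \<open>g\<^sub>i(f)\<close> are zero, whereas the composite must be a rational map.  Outside
  characteristic \<open>2\<close> this says that \<open>f\<close> is not injective because it is unchanged when the signs of
  the variables in \<open>S\<close> are flipped; the grading argument covers all characteristics.
\<close>

lemma birational_even_on_imp_UNIV: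
  assumes "birational f" and even: "\<And>i. even_on S (f i)" and "S \<noteq> {}"
  shows "S = UNIV"
proof (rule ccontr)
  assume "S \<noteq> UNIV"
  from assms(1) obtain g where g: "same_rational_map (\<lambda>i. subst f (g i)) var"
    unfolding birational_def by blast
  define h where "h i = subst f (g i)" for i
  have h_even: "even_on S (h i)" for i
    unfolding h_def by (rule even_on_subst[OF even])
  have cross: "h i * var j = h j * var i" for i j
    using g by (simp add: same_rational_map_def h_def)
  have zero: "h i = 0 \<and> h j = 0" if ij: "i \<in> S" "j \<notin> S" for i j
  proof -
    have "Poly_Mapping.keys (h i * var j) = {}"
    proof (rule ccontr)
      assume "Poly_Mapping.keys (h i * var j) \<noteq> {}"
      then obtain w where w: "w \<in> Poly_Mapping.keys (h i * var j)" by (meson equals0I)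
      from ij have "even_on S (h i * var j)"
        unfolding var_def mon_def
        by (intro even_on_mult h_even even_on_single) (simp add: axis_def)
      with w have "even (\<Sum>l\<in>S. w $ l)" by (simp add: even_on_def)
      moreover obtain u where "u \<in> Poly_Mapping.keys (h j)" "w = u + axis i 1"
        using w[unfolded cross[of i j]] keys_mult[of "h j" "var i"]
        by (auto simp: var_def mon_def)
      then have "odd (\<Sum>l\<in>S. w $ l)"
        using h_even[of j] ij by (simp add: even_on_def sum.distrib axis_def)
      ultimately show False by simp
    qed
    then have "h i * var j = 0" "h j * var i = 0" by (auto simp: cross)
    then show ?thesis by (simp add: mult.commute[of "h _"] var_def mon_mult_eq_0_iff)
  qed
  with \<open>S \<noteq> {}\<close> \<open>S \<noteq> UNIV\<close> have "h i = 0" for i by blast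
  then show False
    using g by (simp add: same_rational_map_def rational_map_def h_def)
qed

section \<open>Cycles as sets of edges\<close>

definition cycle_edges :: "'a list \<Rightarrow> 'a set set" where
  "cycle_edges c = {{c ! t, c ! (Suc t mod length c)} | t. t < length c}"

lemma is_circuit_iff:
  "is_circuit F C \<longleftrightarrow>
     C \<subseteq> graph_edges F \<and> (\<exists>c. distinct c \<and> length c \<ge> 3 \<and> C = cycle_edges c)"
  by (simp add: is_circuit_def cycle_edges_def)

lemma cycle_edges_conv_image:
  "cycle_edges c = (\<lambda>t. {c ! t, c ! (Suc t mod length c)}) ` {..<length c}"
  by (auto simp: cycle_edges_def)

lemma cycle_edges_triangle: "cycle_edges [x, y, z] = {{x, y}, {y, z}, {z, x}}"
proof -
  have "{..<length [x, y, z]} = {0, 1, 2}" by auto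
  then show ?thesis unfolding cycle_edges_conv_image by simp
qed

lemma Union_cycle_edges: "\<Union>(cycle_edges c) = set c"
proof
  have "Suc t mod length c < length c" if "t < length c" for t
    using that by (intro mod_less_divisor) linarith
  then show "\<Union>(cycle_edges c) \<subseteq> set c"
    by (auto simp: cycle_edges_def)
  show "set c \<subseteq> \<Union>(cycle_edges c)"
    unfolding cycle_edges_def in_set_conv_nth by (rule subsetI) (auto simp: in_set_conv_nth)
qed

text \<open>
  Two different steps of a cycle use the same pair of vertices only if each is the successor of the other,
  which forces length \<open>2\<close>.
\<close>

lemma inj_on_cycle_edge:
  assumes c: "distinct c" "length c \<ge> 3"
  shows "inj_on (\<lambda>t. {c ! t, c ! (Suc t mod length c)}) {..<length c}"
proof (rule inj_onI)
  fix s t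
  let ?r = "length c"
  assume st: "s \<in> {..<?r}" "t \<in> {..<?r}"
    and eq: "{c ! s, c ! (Suc s mod ?r)} = {c ! t, c ! (Suc t mod ?r)}"
  have lt: "Suc u mod ?r < ?r" for u using c by (intro mod_less_divisor) linarith
  from eq st lt c(1) have "s = t \<or> (s = Suc t mod ?r \<and> Suc s mod ?r = t)"
    by (auto simp: doubleton_eq_iff nth_eq_iff_index_eq)
  with st c(2) show "s = t"
    by (auto simp: mod_Suc split: if_splits)
qed

lemma card_cycle_edges:
  assumes "distinct c" "length c \<ge> 3"
  shows "card (cycle_edges c) = length c"
  by (simp add: cycle_edges_conv_image card_image[OF inj_on_cycle_edge[OF assms]])

lemma cycle_degree:
  assumes c: "distinct c" "length c \<ge> 3" and "v \<in> set c"
  shows "card {e \<in> cycle_edges c. v \<in> e} = 2"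
proof -
  let ?r = "length c"
  let ?e = "\<lambda>t. {c ! t, c ! (Suc t mod ?r)}"
  obtain t where t: "t < ?r" "v = c ! t"
    using \<open>v \<in> set c\<close> by (auto simp: in_set_conv_nth)
  \<comment> \<open>the position before \<open>t\<close>, whose edge is the other one at \<open>v\<close>\<close>
  define p where "p = (if t = 0 then ?r - 1 else t - 1)"
  have p: "p < ?r" "p \<noteq> t" "Suc p mod ?r = t"
    using t c by (auto simp: p_def)
  have lt: "Suc u mod ?r < ?r" for u using c by (intro mod_less_divisor) linarith
  have "v \<in> ?e s \<longleftrightarrow> s = t \<or> s = p" if "s < ?r" for s
  proof -
    have "v \<in> ?e s \<longleftrightarrow> t = s \<or> t = Suc s mod ?r"
      using t that lt c by (auto simp: nth_eq_iff_index_eq)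
    also have "t = Suc s mod ?r \<longleftrightarrow> s = p"
      using that p t c by (auto simp: mod_Suc p_def split: if_splits)
    finally show ?thesis by auto
  qed
  then have "{e \<in> cycle_edges c. v \<in> e} = ?e ` {t, p}"
    using t p by (auto simp: cycle_edges_def)
  moreover have "card (?e ` {t, p}) = card {t, p}"
    using t p by (intro card_image inj_on_subset[OF inj_on_cycle_edge[OF c]]) auto
  ultimately show ?thesis using p by simp
qed

text \<open>
  All vertices of a cycle have degree \<open>2\<close>, so the smaller cycle contains both \<open>c\<close>-edges at each of
  its vertices.  Walking around \<open>c\<close> from a common vertex therefore never leaves \<open>d\<close>.
\<close>

lemma cycle_edges_subset_imp_eq:
  assumes c: "distinct c" "length c \<ge> 3" and d: "distinct d" "length d \<ge> 3"
    and sub: "cycle_edges d \<subseteq> cycle_edges c"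
  shows "cycle_edges d = cycle_edges c"
proof -
  let ?r = "length c"
  have fin: "finite (cycle_edges c)" by (simp add: cycle_edges_def)
  have set_sub: "set d \<subseteq> set c"
    using Union_mono[OF sub] by (simp add: Union_cycle_edges)
  have all_edges: "e \<in> cycle_edges d" if "e \<in> cycle_edges c" "v \<in> e" "v \<in> set d" for e v
  proof -
    have "{e \<in> cycle_edges d. v \<in> e} = {e \<in> cycle_edges c. v \<in> e}"
      using sub set_sub that fin by (intro card_subset_eq) (auto simp: cycle_degree c d)
    with that show ?thesis by blast
  qed
  have rotate: "c ! ((t + k) mod ?r) \<in> set d" if "t < ?r" "c ! t \<in> set d" for t k
  proof (induction k)
    case 0
    with that show ?case by simp
  next
    case (Suc k)
    let ?s = "(t + k) mod ?r"
    have "?s < ?r" using that by (intro mod_less_divisor) linarith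
    then have "{c ! ?s, c ! (Suc ?s mod ?r)} \<in> cycle_edges c"
      by (auto simp: cycle_edges_def)
    from all_edges[OF this _ Suc] have "{c ! ?s, c ! (Suc ?s mod ?r)} \<in> cycle_edges d"
      by simp
    then have "c ! (Suc ?s mod ?r) \<in> \<Union>(cycle_edges d)" by blast
    then show ?case by (simp add: Union_cycle_edges mod_Suc_eq)
  qed
  have "set c \<subseteq> set d"
  proof
    fix v assume "v \<in> set c"
    then obtain s where s: "s < ?r" "v = c ! s" by (auto simp: in_set_conv_nth)
    have "d ! 0 \<in> set d" using d by (intro nth_mem) linarith
    then obtain t where t: "t < ?r" "c ! t \<in> set d"
      using set_sub by (metis in_set_conv_nth subsetD)
    \<comment> \<open>\<open>s + ?r - t\<close> steps lead from position \<open>t\<close> to position \<open>s\<close>, also when \<open>s < t\<close>\<close>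
    have "(t + (s + ?r - t)) mod ?r = s" using s t by simp
    with rotate[OF t, of "s + ?r - t"] s show "v \<in> set d" by simp
  qed
  moreover have "e \<inter> set c \<noteq> {}" if "e \<in> cycle_edges c" for e
    using that Union_cycle_edges[of c] by (auto simp: cycle_edges_def)
  ultimately have "cycle_edges c \<subseteq> cycle_edges d"
    using all_edges by blast
  with sub show ?thesis by blast
qed

section \<open>Monomials as edges of a graph\<close>

definition edge :: "'n::finite monomials \<Rightarrow> 'n \<Rightarrow> 'n set" where
  "edge F j = {i. F j $ i = 1}"

locale edge_ideal =
  fixes F :: "'n::finite monomials"
  assumes inj: "inj F" and degree: "in_degree 2 F" and squarefree: "squarefree_set F"
begin

lemma exponent: "F j $ i = of_bool (i \<in> edge F j)"
  using squarefree by (auto simp: edge_def squarefree_set_def le_Suc_eq)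

lemma sum_exponents: "(\<Sum>i\<in>S. F j $ i) = card (S \<inter> edge F j)"
  by (simp add: exponent of_bool_def sum.If_cases Int_def)

lemma card_edge: "card (edge F j) = 2"
  using degree sum_exponents[of j UNIV] by (simp add: in_degree_def mon_degree_def)

lemma edge_eq_iff: "edge F i = edge F j \<longleftrightarrow> i = j"
proof
  assume "edge F i = edge F j"
  then have "F i = F j" by (simp add: vec_eq_iff exponent)
  with inj show "i = j" by (simp add: inj_eq)
qed simp

lemma axis_sum_eq_iff:
  assumes "p \<noteq> q"
  shows "axis p 1 + axis q 1 = F j \<longleftrightarrow> edge F j = {p, q}"
proof -
  have "(axis p 1 + axis q 1) $ i = (of_bool (i \<in> {p, q}) :: nat)" for i
    using assms by (auto simp: axis_def)
  then show ?thesis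
    by (auto simp: vec_eq_iff exponent set_eq_iff simp del: insert_iff)
qed

lemma graph_edges_eq: "graph_edges F = range (edge F)"
proof (intro equalityI subsetI)
  fix e assume "e \<in> graph_edges F"
  then obtain p q j where "e = {p, q}" "p \<noteq> q" "axis p 1 + axis q 1 = F j"
    by (auto simp: graph_edges_def)
  then show "e \<in> range (edge F)"
    using axis_sum_eq_iff[of p q j] by blast
next
  fix e assume "e \<in> range (edge F)"
  then obtain j where j: "e = edge F j" by blast
  then obtain p q where "e = {p, q}" "p \<noteq> q"
    using card_edge[of j] by (auto simp: card_2_iff)
  with j show "e \<in> graph_edges F"
    using axis_sum_eq_iff[of p q j] unfolding graph_edges_def by blast
qed

lemma card_graph_edges: "card (graph_edges F) = CARD('n)"
  unfolding graph_edges_eq by (intro card_image) (simp add: inj_on_def edge_eq_iff)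

lemma row_sum: "(\<Sum>j\<in>UNIV. F j $ i) = card {e \<in> graph_edges F. i \<in> e}"
proof -
  have "(\<Sum>j\<in>UNIV. F j $ i) = card {j. i \<in> edge F j}"
    by (simp add: exponent of_bool_def sum.If_cases)
  also have "\<dots> = card (edge F ` {j. i \<in> edge F j})"
    by (intro card_image[symmetric]) (simp add: inj_on_def edge_eq_iff)
  also have "edge F ` {j. i \<in> edge F j} = {e \<in> graph_edges F. i \<in> e}"
    by (auto simp: graph_edges_eq)
  finally show ?thesis .
qed

end

text \<open>
  Each edge lies inside a union \<open>S\<close> of connected components or is disjoint from it, so all monomials
  have degree \<open>2\<close> or \<open>0\<close> in the variables of \<open>S\<close>.
\<close>

lemma (in edge_ideal) cremona_imp_connected:
  assumes "cremona_set k F" "S \<noteq> {}"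
    and closed: "\<And>u v. u \<in> S \<Longrightarrow> {u, v} \<in> graph_edges F \<Longrightarrow> v \<in> S"
  shows "S = UNIV"
proof (rule birational_even_on_imp_UNIV)
  show "birational (\<lambda>j. mon (F j) :: ('n, 'a) mpol)"
    using assms(1) by (simp add: cremona_set_def)
  show "even_on S (mon (F j) :: ('n, 'a) mpol)" for j
    unfolding mon_def
  proof (rule even_on_single)
    obtain p q where pq: "edge F j = {p, q}" "p \<noteq> q"
      using card_edge[of j] by (auto simp: card_2_iff)
    then have "{p, q} \<in> graph_edges F" "{q, p} \<in> graph_edges F"
      by (auto simp: graph_edges_eq insert_commute)
    with closed have "p \<in> S \<longleftrightarrow> q \<in> S" by blast
    then have "S \<inter> edge F j = {} \<or> S \<inter> edge F j = edge F j"
      using pq by auto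
    then show "even (\<Sum>i\<in>S. F j $ i)"
      by (auto simp: sum_exponents card_edge)
  qed
qed (fact assms(2))

section \<open>Neighborhoods of a circuit\<close>

lemma neighborhood_0: "neighborhood F C 0 = \<Union>C"
  unfolding neighborhood_def by (simp del: Union_iff)

lemma neighborhood_1:
  "neighborhood F C 1 = {v. v \<notin> \<Union>C \<and> (\<exists>u\<in>\<Union>C. {u, v} \<in> graph_edges F)}"
proof -
  have "adjacency F ^^ 1 = adjacency F" by simp
  then show ?thesis
    unfolding neighborhood_def less_one by (simp add: adjacency_def del: Union_iff) blast
qed

lemma neighborhood_2I:
  assumes "u \<in> \<Union>C" "{u, w} \<in> graph_edges F" "{w, v} \<in> graph_edges F"
    and "v \<notin> \<Union>C" "v \<notin> neighborhood F C 1"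
  shows "v \<in> neighborhood F C 2"
proof -
  have "(u, v) \<in> adjacency F ^^ 2"
    using assms(2,3) by (auto simp: adjacency_def numeral_2_eq_2)
  moreover have "(x, v) \<notin> adjacency F ^^ m" if "m < 2" "x \<in> \<Union>C" for m x
  proof -
    from \<open>m < 2\<close> consider "m = 0" | "m = 1" by linarith
    then show ?thesis
    proof cases
      case 1
      with assms(4) \<open>x \<in> \<Union>C\<close> show ?thesis by (simp del: Union_iff) blast
    next
      case 2
      have "{x, v} \<notin> graph_edges F"
        using assms(4,5) \<open>x \<in> \<Union>C\<close> unfolding neighborhood_1 by blast
      with 2 show ?thesis by (simp add: adjacency_def)
    qed
  qed
  ultimately show ?thesis
    unfolding neighborhood_def using assms(1) by blast
qed

section \<open>Involutions up to permutation\<close>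

lemma permutation_matrix_mult_nth:
  fixes A :: "nat ^ 'n ^ 'n::finite"
  assumes "bij \<pi>"
  shows "((\<chi> i j. if i = \<pi> j then 1 else 0) ** A ** (\<chi> i j. if i = \<rho> j then 1 else 0)) $ l $ j
    = A $ inv \<pi> l $ \<rho> j"
proof -
  have "l = \<pi> b \<longleftrightarrow> b = inv \<pi> l" for b
    using assms by (metis bij_inv_eq_iff)
  then show ?thesis
    by (simp add: matrix_matrix_mult_def if_distrib[of "\<lambda>x. x * _"] if_distrib[of "\<lambda>x. _ * x"]
        cong: if_cong)
qed

lemma mon_dvd_axis_iff: "mon_dvd (axis i 1) v \<longleftrightarrow> 1 \<le> v $ i"
proof
  assume "mon_dvd (axis i 1) v"
  then have "axis i 1 $ i \<le> v $ i" unfolding mon_dvd_def by blast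
  then show "1 \<le> v $ i" by simp
next
  assume "1 \<le> v $ i"
  then show "mon_dvd (axis i 1) v" by (simp add: mon_dvd_def axis_def)
qed

context edge_ideal
begin

text \<open>
  For \<open>G\<close> obtained from \<open>F\<close> by permutations, a column of \<open>A\<^sub>F A\<^sub>G\<close> is the sum of the exponent vectors of
  two edges of the graph.  This turns the defining equation of the inverse set into a statement
  about pairs of edges.
\<close>

lemma log_matrix_mult_permuted:
  assumes "bij \<pi>" and G: "\<And>l. G j $ l = F (\<rho> j) $ inv \<pi> l"
  shows "(log_matrix F ** log_matrix G) $ i $ j = (\<Sum>b\<in>edge F (\<rho> j). F (\<pi> b) $ i)"
proof -
  have "(log_matrix F ** log_matrix G) $ i $ j = (\<Sum>l\<in>UNIV. F l $ i * F (\<rho> j) $ inv \<pi> l)"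
    by (simp add: matrix_matrix_mult_def log_matrix_def G)
  also have "\<dots> = (\<Sum>b\<in>UNIV. F (\<pi> b) $ i * F (\<rho> j) $ b)"
    by (subst sum.reindex_bij_betw[OF assms(1), symmetric])
       (simp add: bij_is_inj[OF assms(1)])
  also have "\<dots> = (\<Sum>b\<in>edge F (\<rho> j). F (\<pi> b) $ i)"
    by (intro sum.mono_neutral_cong_right) (auto simp: exponent[of "\<rho> j"])
  finally show ?thesis .
qed

lemma p_involution_imp_permutations:
  assumes "p_involution F"
  obtains \<pi> \<rho> \<gamma> where "bij \<pi>" "bij \<rho>"
    "\<And>i j. (\<Sum>b\<in>edge F (\<rho> j). F (\<pi> b) $ i) = \<gamma> i + of_bool (i = j)"
proof -
  obtain G P Q where "inverse_set F G" "permutation_matrix P" "permutation_matrix Q"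
    and G: "log_matrix G = P ** log_matrix F ** Q"
    using assms unfolding p_involution_def by blast
  then obtain \<pi> \<rho> and \<gamma> :: "nat ^ 'n" where bij: "bij \<pi>" "bij \<rho>"
    and P: "P = (\<chi> i j. if i = \<pi> j then 1 else 0)" and Q: "Q = (\<chi> i j. if i = \<rho> j then 1 else 0)"
    and eq: "log_matrix F ** log_matrix G = (\<chi> i j. \<gamma> $ i) + mat 1"
    unfolding permutation_matrix_def inverse_set_def by blast
  have "G j $ l = log_matrix G $ l $ j" for l j
    by (simp add: log_matrix_def)
  then have "G j $ l = F (\<rho> j) $ inv \<pi> l" for l j
    unfolding G P Q permutation_matrix_mult_nth[OF bij(1)] by (simp add: log_matrix_def)
  then have "(\<Sum>b\<in>edge F (\<rho> j). F (\<pi> b) $ i) = (log_matrix F ** log_matrix G) $ i $ j" for i j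
    using log_matrix_mult_permuted[OF bij(1), of G j \<rho> i] by simp
  then have "(\<Sum>b\<in>edge F (\<rho> j). F (\<pi> b) $ i) = \<gamma> $ i + of_bool (i = j)" for i j
    by (simp add: eq mat_def)
  with bij that show ?thesis by blast
qed

lemma p_involutionI:
  assumes canonical: "canonical_restrictions F" and bij: "bij \<pi>" "bij \<rho>"
    and eq: "\<And>i j. (\<Sum>b\<in>edge F (\<rho> j). F (\<pi> b) $ i) = \<gamma> i + of_bool (i = j)"
  shows "p_involution F"
proof -
  define G where "G j = (\<chi> l. F (\<rho> j) $ inv \<pi> l)" for j
  have inv: "inv \<pi> (\<pi> b) = b" "\<pi> (inv \<pi> b) = b" for b
    using bij(1) by (simp_all add: bij_is_inj bij_is_surj surj_f_inv_f)
  have "monomial_set G"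
    unfolding monomial_set_def
  proof (intro conjI exI allI injI)
    fix x y assume "G x = G y"
    then have "F (\<rho> x) $ inv \<pi> (\<pi> b) = F (\<rho> y) $ inv \<pi> (\<pi> b)" for b
      by (simp only: G_def vec_eq_iff vec_lambda_beta)
    then have "F (\<rho> x) = F (\<rho> y)" by (simp add: vec_eq_iff inv)
    then show "x = y" using inj bij(2) by (simp add: inj_eq bij_is_inj)
  next
    fix j
    have "mon_degree (G j) = (\<Sum>b\<in>UNIV. F (\<rho> j) $ b)"
      unfolding mon_degree_def G_def
      by (simp add: sum.reindex_bij_betw[OF bij_imp_bij_inv[OF bij(1)]])
    then show "mon_degree (G j) = 2" by (simp add: sum_exponents card_edge)
  qed
  moreover have "canonical_restrictions G"
    unfolding canonical_restrictions_def
  proof (intro conjI allI impI)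
    fix w assume w: "\<forall>j. mon_dvd w (G j)"
    have "w $ \<pi> b \<le> F (\<rho> j) $ b" for b j
      using w inv(1)[of b] unfolding mon_dvd_def G_def by (metis vec_lambda_beta)
    then have "mon_dvd (\<chi> b. w $ \<pi> b) (F j)" for j
      unfolding mon_dvd_def by (metis vec_lambda_beta bij_pointE[OF bij(2)])
    with canonical have "(\<chi> b. w $ \<pi> b) = 0"
      by (simp add: canonical_restrictions_def)
    then have "w $ \<pi> (inv \<pi> l) = 0" for l
      by (simp only: vec_eq_iff vec_lambda_beta zero_index)
    then show "w = 0" by (simp add: vec_eq_iff inv)
  next
    fix i
    obtain j where "mon_dvd (axis (inv \<pi> i) 1) (F j)"
      using canonical by (auto simp: canonical_restrictions_def)
    moreover obtain j' where "j = \<rho> j'"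
      using bij(2) by (metis bij_pointE)
    ultimately show "\<exists>j. mon_dvd (axis i 1) (G j)"
      unfolding mon_dvd_axis_iff G_def by auto
  qed
  moreover have "log_matrix F ** log_matrix G = (\<chi> i j. (\<chi> i. \<gamma> i) $ i) + mat 1"
    using eq log_matrix_mult_permuted[OF bij(1), of G _ \<rho>]
    by (simp add: vec_eq_iff mat_def G_def)
  ultimately have "inverse_set F G"
    unfolding inverse_set_def by blast
  moreover have "log_matrix G = (\<chi> i j. if i = \<pi> j then 1 else 0) ** log_matrix F **
      (\<chi> i j. if i = \<rho> j then 1 else 0)"
    unfolding vec_eq_iff permutation_matrix_mult_nth[OF bij(1)]
    by (simp add: log_matrix_def G_def)
  ultimately show ?thesis
    unfolding p_involution_def permutation_matrix_def using bij by blast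
qed

text \<open>
  Let \<open>A\<^sub>F A\<^sub>G = [\<gamma>|\<dots>|\<gamma>] + I\<close> with \<open>G\<close> a permuted copy of \<open>F\<close>.  Then for every vertex \<open>j\<close>,
  \<open>\<gamma>\<close> plus the \<open>j\<close>th unit vector is a sum of two edges.  The entries of such a sum are at most \<open>2\<close> and add
  up to \<open>4\<close>; as \<open>j\<close> is arbitrary, \<open>\<gamma>\<close> is the indicator of a set \<open>\<Gamma>\<close> of three vertices.  For \<open>j \<in> \<Gamma>\<close>
  the two edges must be those joining \<open>j\<close> to the other elements of \<open>\<Gamma>\<close>, so \<open>\<Gamma>\<close> spans a triangle.
\<close>

lemma p_involution_imp_triangle:
  assumes "p_involution F"
  shows "\<exists>D. is_circuit F D \<and> card D = 3"
proof -
  obtain \<pi> \<rho> \<gamma> where bij: "bij \<pi>" "bij \<rho>"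
    and eq: "\<And>i j. (\<Sum>b\<in>edge F (\<rho> j). F (\<pi> b) $ i) = \<gamma> i + of_bool (i = j)"
    using p_involution_imp_permutations[OF assms] by blast
  have two_edges: "\<exists>e e'. e \<in> graph_edges F \<and> e' \<in> graph_edges F \<and> card e = 2 \<and> card e' = 2 \<and>
      (\<forall>i. of_bool (i \<in> e) + of_bool (i \<in> e') = \<gamma> i + of_bool (i = j))" for j
  proof -
    obtain p q where pq: "edge F (\<rho> j) = {p, q}" "p \<noteq> q"
      using card_edge[of "\<rho> j"] by (auto simp: card_2_iff)
    then have "F (\<pi> p) $ i + F (\<pi> q) $ i = \<gamma> i + of_bool (i = j)" for i
      using eq[where i = i and j = j] by simp
    then have "of_bool (i \<in> edge F (\<pi> p)) + of_bool (i \<in> edge F (\<pi> q)) = \<gamma> i + of_bool (i = j)" for i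
      unfolding exponent .
    then show ?thesis
      using card_edge graph_edges_eq by blast
  qed
  define \<Gamma> where "\<Gamma> = {i. \<gamma> i = 1}"
  have \<gamma>: "\<gamma> i = of_bool (i \<in> \<Gamma>)" for i
  proof -
    \<comment> \<open>the two edges for \<open>j = i\<close> cover \<open>i\<close> at most twice, which leaves at most \<open>1\<close> for \<open>\<gamma> i\<close>\<close>
    obtain e e' :: "'n set"
      where "\<forall>x. of_bool (x \<in> e) + of_bool (x \<in> e') = \<gamma> x + of_bool (x = i)"
      using two_edges[of i] by blast
    then have "of_bool (i \<in> e) + of_bool (i \<in> e') = \<gamma> i + 1" by simp
    moreover have "of_bool (i \<in> e) \<le> (1::nat)" "of_bool (i \<in> e') \<le> (1::nat)" by auto
    ultimately have "\<gamma> i \<le> 1" by linarith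
    then show ?thesis by (auto simp: \<Gamma>_def)
  qed
  have "card \<Gamma> = 3"
  proof -
    fix j :: 'n
    obtain e e' where e: "card e = 2" "card e' = 2"
      and i: "\<And>i. of_bool (i \<in> e) + of_bool (i \<in> e') = of_bool (i \<in> \<Gamma>) + (of_bool (i = j) :: nat)"
      using two_edges[of j] \<gamma> by auto
    \<comment> \<open>comparing degrees: \<open>2 + 2 = card \<Gamma> + 1\<close>\<close>
    have "(\<Sum>i\<in>UNIV. of_bool (i \<in> e) + of_bool (i \<in> e'))
        = (\<Sum>i\<in>UNIV. of_bool (i \<in> \<Gamma>) + (of_bool (i = j) :: nat))"
      by (simp only: i)
    then show ?thesis by (simp add: sum.distrib of_bool_def sum.If_cases e)
  qed
  then obtain a b c where abc: "\<Gamma> = {a, b, c}" "a \<noteq> b" "a \<noteq> c" "b \<noteq> c"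
    by (auto simp: card_3_iff)
  have adjacent: "{x, y} \<in> graph_edges F" if xy: "x \<in> \<Gamma>" "y \<in> \<Gamma>" "x \<noteq> y" for x y
  proof -
    obtain e e' where e: "e \<in> graph_edges F" "e' \<in> graph_edges F" "card e = 2" "card e' = 2"
      and i: "\<And>i. of_bool (i \<in> e) + of_bool (i \<in> e') = of_bool (i \<in> \<Gamma>) + (of_bool (i = x) :: nat)"
      using two_edges[of x] \<gamma> by auto
    have "x \<in> e \<and> x \<in> e'" using i[of x] xy by (auto simp: of_bool_def split: if_splits)
    moreover have "y \<in> e \<or> y \<in> e'" using i[of y] xy by (auto simp: of_bool_def split: if_splits)
    ultimately show ?thesis
      using e xy by (auto simp: card_2_iff doubleton_eq_iff insert_commute)
  qed
  have "cycle_edges [a, b, c] \<subseteq> graph_edges F"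
    unfolding cycle_edges_triangle using abc adjacent by auto
  with abc have "is_circuit F (cycle_edges [a, b, c])"
    unfolding is_circuit_iff by (intro conjI exI[of _ "[a, b, c]"]) auto
  moreover have "card (cycle_edges [a, b, c]) = 3"
    using abc card_cycle_edges[of "[a, b, c]"] by simp
  ultimately show ?thesis by blast
qed

end

section \<open>A circuit with leaves\<close>

locale circuit_with_leaves = edge_ideal F for F :: "'n::finite monomials" +
  fixes C :: "'n set set"
  assumes circuit: "is_circuit F C"
    and spanning: "\<And>v. v \<notin> \<Union>C \<Longrightarrow> \<exists>u\<in>\<Union>C. {u, v} \<in> graph_edges F"
begin

abbreviation vertices :: "'n set" where
  "vertices \<equiv> \<Union>C"

text \<open>
  Once the edges have been counted, \<open>hub v\<close> turns out to be the only neighbor of a vertex \<open>v\<close> off the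
  circuit.
\<close>

definition hub :: "'n \<Rightarrow> 'n" where
  "hub v = (SOME u. u \<in> vertices \<and> {u, v} \<in> graph_edges F)"

lemma hub:
  assumes "v \<notin> vertices"
  shows "hub v \<in> vertices" "{hub v, v} \<in> graph_edges F"
proof -
  have "hub v \<in> vertices \<and> {hub v, v} \<in> graph_edges F"
    unfolding hub_def by (rule someI_ex) (use spanning[OF assms] in blast)
  then show "hub v \<in> vertices" "{hub v, v} \<in> graph_edges F" by simp_all
qed

lemma C_subset: "C \<subseteq> graph_edges F"
  using circuit by (simp add: is_circuit_def)

lemma circuit_list:
  obtains c where "distinct c" "length c \<ge> 3" "C = cycle_edges c" "set c = vertices"
    "length c = card C"
  using circuit unfolding is_circuit_iff by (metis Union_cycle_edges card_cycle_edges)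

lemma card_vertices: "card vertices = card C"
  by (metis circuit_list distinct_card)

text \<open>
  The circuit has as many edges as vertices, and each vertex off the circuit contributes a further
  edge of its own.  This already accounts for as many edges as there are vertices in total, and the
  graph has no more.
\<close>

lemma graph_edges_eq_circuit_leaves:
  "graph_edges F = C \<union> (\<lambda>v. {hub v, v}) ` (- vertices)" (is "_ = C \<union> ?f ` _")
proof -
  have "inj_on ?f (- vertices)"
    using hub by (auto simp: inj_on_def doubleton_eq_iff)
  moreover have "C \<inter> ?f ` (- vertices) = {}"
    by blast
  moreover have fin: "finite C" using C_subset by (rule finite_subset) simp
  ultimately have "card (C \<union> ?f ` (- vertices)) = card C + card (- vertices)"
    by (simp add: card_Un_disjoint card_image)
  also have "\<dots> = card (graph_edges F)"
    unfolding card_graph_edges card_vertices[symmetric]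
    by (subst card_Un_disjoint[symmetric]) auto
  finally show ?thesis
    using C_subset hub by (intro card_subset_eq[symmetric]) auto
qed

lemma leaf_edge:
  assumes "e \<in> graph_edges F" "v \<in> e" "v \<notin> vertices"
  shows "e = {hub v, v}"
proof -
  have "e \<notin> C" using assms(2,3) by blast
  then obtain w where w: "w \<notin> vertices" "e = {hub w, w}"
    using assms(1) unfolding graph_edges_eq_circuit_leaves by blast
  with hub(1)[of w] assms(2,3) have "v = w" by blast
  with w show ?thesis by simp
qed

text \<open>
  By the count of edges a vertex off the circuit \<open>C\<close> is a leaf, so no circuit passes through it.
\<close>

lemma unique_circuit:
  assumes "is_circuit F D"
  shows "D = C"
proof -
  obtain d where d: "distinct d" "length d \<ge> 3" "D = cycle_edges d" "D \<subseteq> graph_edges F"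
    using assms unfolding is_circuit_iff by blast
  have "v \<in> vertices" if "v \<in> set d" for v
  proof (rule ccontr)
    assume "v \<notin> vertices"
    then have "{e \<in> D. v \<in> e} \<subseteq> {{hub v, v}}"
      using leaf_edge d(4) by blast
    then have "card {e \<in> D. v \<in> e} \<le> 1"
      using card_mono[of "{{hub v, v}}"] by fastforce
    with cycle_degree[OF d(1,2) that] d(3) show False by simp
  qed
  then have "\<Union>D \<subseteq> vertices" by (auto simp: d(3) Union_cycle_edges)
  then have "D \<subseteq> C" using d(4) unfolding graph_edges_eq_circuit_leaves by blast
  then show ?thesis
    by (metis circuit_list cycle_edges_subset_imp_eq d(1-3))
qed

lemma neighborhood_1_eq: "neighborhood F C 1 = - vertices"
  unfolding neighborhood_1 using spanning by (intro equalityI subsetI CollectI conjI ComplI) simp_all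

lemma neighborhood_edges_1_eq: "neighborhood_edges F C 1 = (\<lambda>v. {hub v, v}) ` (- vertices)"
proof -
  have "neighborhood_edges F C 1 = {{u, v} | u v. u \<in> vertices \<and> v \<notin> vertices \<and> {u, v} \<in> graph_edges F}"
    unfolding neighborhood_edges_def diff_self_eq_0 neighborhood_0 neighborhood_1_eq by simp
  also have "\<dots> = (\<lambda>v. {hub v, v}) ` (- vertices)"
  proof (intro equalityI subsetI)
    fix e assume "e \<in> {{u, v} | u v. u \<in> vertices \<and> v \<notin> vertices \<and> {u, v} \<in> graph_edges F}"
    then obtain v where "e \<in> graph_edges F" "v \<in> e" "v \<notin> vertices" by blast
    then have "e = {hub v, v}" "v \<in> - vertices" using leaf_edge by simp_all
    then show "e \<in> (\<lambda>v. {hub v, v}) ` (- vertices)" by (rule image_eqI)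
  next
    fix e assume "e \<in> (\<lambda>v. {hub v, v}) ` (- vertices)"
    then obtain v where "v \<notin> vertices" "e = {hub v, v}" by blast
    with hub[of v] show "e \<in> {{u, v} | u v. u \<in> vertices \<and> v \<notin> vertices \<and> {u, v} \<in> graph_edges F}"
      by blast
  qed
  finally show ?thesis .
qed

lemma no_leaves_imp_doubly_stochastic:
  assumes "canonical_restrictions F" "vertices = UNIV"
  shows "doubly_stochastic F"
proof -
  have "graph_edges F = C" using graph_edges_eq_circuit_leaves assms(2) by simp
  then have "(\<Sum>j\<in>UNIV. F j $ i) = 2" for i
    unfolding row_sum by (metis UNIV_I assms(2) circuit_list cycle_degree)
  then show ?thesis
    unfolding doubly_stochastic_def
    using assms(1) squarefree
    by (auto simp: log_matrix_def sum_exponents card_edge intro!: exI[of _ 2])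
qed

text \<open>
  Number the edges by the vertices: a vertex \<open>v\<close> of the triangle \<open>T\<close> gets the opposite edge
  \<open>T - {v}\<close>, and a leaf gets its only edge.  Let \<open>\<phi>\<close> be this bijection.  Applying it to both ends of
  the edge \<open>\<phi> j\<close> gives two edges whose exponent vectors add up to the indicator of \<open>T\<close> plus the
  \<open>j\<close>th unit vector: for \<open>j \<in> T\<close> these are the two triangle edges at \<open>j\<close>, and for a leaf \<open>j\<close>
  they are the edge at \<open>j\<close> and the triangle edge opposite to its hub.  Hence \<open>\<phi>\<close>, used both on the
  source and on the target, carries \<open>F\<close> to its inverse.
\<close>

lemma triangle_imp_p_involution:
  assumes canonical: "canonical_restrictions F" and "card C = 3"
  shows "p_involution F"
proof -
  define T where "T = vertices"
  note hub = hub[folded T_def]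
  have opposite: "T - {v} \<in> C" if "v \<in> T" for v
  proof -
    obtain c where c: "distinct c" "length c = 3" "C = cycle_edges c" "set c = T"
      using circuit_list assms(2) unfolding T_def by metis
    then obtain x y z where xyz: "c = [x, y, z]"
      by (auto simp: length_Suc_conv numeral_3_eq_3)
    have "C = {{x, y}, {y, z}, {z, x}}"
      unfolding c(3) xyz by (rule cycle_edges_triangle)
    moreover have "T = {x, y, z}" "x \<noteq> y" "x \<noteq> z" "y \<noteq> z"
      using c xyz by auto
    ultimately show ?thesis using that by auto
  qed
  define \<phi> where "\<phi> v = (if v \<in> T then T - {v} else {hub v, v})" for v
  have "\<phi> v \<in> graph_edges F" for v
    using opposite[of v] C_subset hub[of v] by (auto simp: \<phi>_def)
  then have "\<exists>i. edge F i = \<phi> v" for v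
    unfolding graph_edges_eq by (metis imageE)
  then obtain \<pi> where \<pi>: "\<And>v. edge F (\<pi> v) = \<phi> v" by metis
  have "inj \<phi>"
  proof (rule injI)
    fix v w assume "\<phi> v = \<phi> w"
    then show "v = w"
      using hub(1)[of v] hub(1)[of w] by (auto simp: \<phi>_def doubleton_eq_iff split: if_splits)
  qed
  then have "inj \<pi>" using \<pi> by (metis inj_on_def)
  then have bij: "bij \<pi>" by (simp add: bij_def finite_UNIV_inj_surj)
  have sums: "(\<Sum>b\<in>edge F (\<pi> j). F (\<pi> b) $ i) = of_bool (i \<in> T) + of_bool (i = j)" for i j
  proof (cases "j \<in> T")
    case True
    have three: "card T = 3" unfolding T_def using assms(2) card_vertices by simp
    have "(\<Sum>b\<in>edge F (\<pi> j). F (\<pi> b) $ i) = (\<Sum>b\<in>T - {j}. of_bool (i \<in> T - {b}))"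
      unfolding exponent \<pi> using True by (intro sum.cong) (auto simp: \<phi>_def)
    also have "\<dots> = card ((T - {j}) \<inter> {b. i \<in> T - {b}})"
      by (simp add: of_bool_def sum.If_cases)
    also have "(T - {j}) \<inter> {b. i \<in> T - {b}} = (if i \<in> T then T - {i, j} else {})"
      by auto
    also have "card \<dots> = of_bool (i \<in> T) + of_bool (i = j)"
      using True three by (auto simp: card_Diff_subset)
    finally show ?thesis .
  next
    case False
    then have h: "hub j \<noteq> j" "hub j \<in> T" using hub(1)[of j] by auto
    have "edge F (\<pi> j) = {hub j, j}" using False by (simp add: \<pi> \<phi>_def)
    then have "(\<Sum>b\<in>edge F (\<pi> j). F (\<pi> b) $ i) = F (\<pi> (hub j)) $ i + F (\<pi> j) $ i"
      using h by simp
    also have "\<dots> = of_bool (i \<in> T - {hub j}) + of_bool (i \<in> {hub j, j})"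
      unfolding exponent \<pi> using h False by (simp add: \<phi>_def)
    also have "\<dots> = of_bool (i \<in> T) + of_bool (i = j)"
      using h False by auto
    finally show ?thesis .
  qed
  show ?thesis
    by (rule p_involutionI[OF canonical bij bij sums])
qed

end

theorem corollary2p10:
  fixes k :: "'k::field itself"
    and F :: "'n::finite \<Rightarrow> nat ^ 'n"
  assumes "CARD('n) \<ge> 2"
    and "cremona_set k F"
    and "in_degree 2 F"
    and "squarefree_set F"
    and "canonical_restrictions F"
    and "short_type F"
    and "\<not> doubly_stochastic F"
  shows "\<exists>C. is_circuit F C \<and> (\<forall>D. is_circuit F D \<longrightarrow> D = C) \<and>
             card C \<ge> 3 \<and>
             neighborhood F C 1 \<noteq> {} \<and>
             UNIV = \<Union>C \<union> neighborhood F C 1 \<and>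
             graph_edges F = C \<union> neighborhood_edges F C 1 \<and>
             (p_involution F \<longleftrightarrow> card C = 3)"
proof -
  interpret edge_ideal F
    using assms by unfold_locales (simp_all add: cremona_set_def monomial_set_def)
  obtain C where C: "is_circuit F C" "neighborhood F C 2 = {}"
    using assms(6) by (auto simp: short_type_def)
  then obtain c where "length c \<ge> 3" "C = cycle_edges c"
    unfolding is_circuit_iff by blast
  then have "\<Union>C \<noteq> {}"
    using Union_cycle_edges[of c] by auto
  have span: "\<Union>C \<union> neighborhood F C 1 = UNIV"
  proof (rule cremona_imp_connected[OF assms(2)])
    show "\<Union>C \<union> neighborhood F C 1 \<noteq> {}" using \<open>\<Union>C \<noteq> {}\<close> by blast
    fix u v assume u: "u \<in> \<Union>C \<union> neighborhood F C 1" and uv: "{u, v} \<in> graph_edges F"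
    show "v \<in> \<Union>C \<union> neighborhood F C 1"
    proof (cases "u \<in> \<Union>C")
      case True
      with uv show ?thesis unfolding neighborhood_1 by blast
    next
      case False
      then obtain w where "w \<in> \<Union>C" "{w, u} \<in> graph_edges F"
        using u unfolding neighborhood_1 by blast
      then show ?thesis using neighborhood_2I[OF _ _ uv] C(2) by blast
    qed
  qed
  then interpret circuit_with_leaves F C
    unfolding neighborhood_1 using C(1) by unfold_locales (assumption, blast)
  show ?thesis
  proof (intro exI[of _ C] conjI allI impI)
    show "is_circuit F C" by (fact C(1))
    show "D = C" if "is_circuit F D" for D
      using that by (rule unique_circuit)
    show "card C \<ge> 3" by (metis circuit_list)
    show "neighborhood F C 1 \<noteq> {}"
      using no_leaves_imp_doubly_stochastic[OF assms(5)] assms(7) span by auto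
    show "UNIV = \<Union>C \<union> neighborhood F C 1" by (fact span[symmetric])
    show "graph_edges F = C \<union> neighborhood_edges F C 1"
      unfolding neighborhood_edges_1_eq by (rule graph_edges_eq_circuit_leaves)
    show "p_involution F \<longleftrightarrow> card C = 3"
      using p_involution_imp_triangle triangle_imp_p_involution[OF assms(5)] unique_circuit
      by metis
  qed
qed

end
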